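(* Let $\Pi$ be a Coxeter group with minimal generating set $\Sigma$ of simple reflections, let $Q=(\sigma_1,\dots,\sigma_m)$ be a finite sequence of elements of $\Sigma$, and let $\pi\in\Pi$. Let $\Delta=\Delta(Q,\pi)$ be the associated subword complex, and let $R_\Delta$ be its Stanley--Reisner ring over $\mathbb{C}$. Then $R_\Delta$ is Hilbertian if and only if the Demazure product $\delta(Q)$ is not equal to $\pi$.
   Context: The subword complex $\Delta(Q,\pi)$ is the simplicial complex on $[m]=\{1,\dots,m\}$ whose facets are the subsets $F\subseteq[m]$ (subsequences of $Q$) such that the subsequence $(\sigma_i)_{i\in[m]\setminus F}$, with the order inherited from $Q$, is a reduced expression for $\pi$. (If there are no such subsets, the complex has no faces at all.) The Demazure product $\delta(Q)\in\Pi$ is defined recursively: $\delta$ of the empty sequence is the identity, and $\delta(\sigma_1,\dots,\sigma_k)=\delta(\sigma_1,\dots,\sigma_{k-1})\,\sigma_k$ if this product has greater Coxeter length than $\delta(\sigma_1,\dots,\sigma_{k-1})$, and $\delta(\sigma_1,\dots,\sigma_k)=\delta(\sigma_1,\dots,\sigma_{k-1})$ otherwise. The Stanley--Reisner ring of a simplicial complex $\Delta$ on $[m]$ is $R_\Delta=\mathbb{C}[x_1,\dots,x_m]/I_\Delta$, where $I_\Delta$ is the square-free monomial ideal generated by the monomials $\prod_{i\in\tau}x_i$ with $\tau\subseteq[m]$, $\tau\notin\Delta$. It carries the standard grading ($\deg x_i=1$). For a graded quotient $R=\bigoplus_{k\geq0}R_k$ of a standard graded polynomial ring over $\mathbb{C}$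 by a homogeneous ideal, the Hilbert function is $HF_R(k)=\dim_{\mathbb{C}}(R_k)$, and the Hilbert polynomial $HP_R$ is the unique polynomial with $HF_R(k)=HP_R(k)$ for all sufficiently large $k$. The ring $R$ is Hilbertian if $HF_R(k)=HP_R(k)$ for all integers $k\geq0$. *)

theory Defs
  imports
    "HOL-Library.Poly_Mapping"
    "HOL-Computational_Algebra.Polynomial"
    "HOL-Algebra.QuotRing"
    "HOL-Algebra.Generated_Groups"
    "Jordan_Normal_Form.VS_Connect"
begin

section \<open>Coxeter systems\<close>

text \<open>A Coxeter matrix on \<open>S\<close>, with the value \<open>0\<close> encoding \<open>\<infinity>\<close>
  (that is, no relation between \<open>s\<close> and \<open>t\<close>).\<close>

definition coxeter_matrix :: "'a set \<Rightarrow> ('a \<Rightarrow> 'a \<Rightarrow> nat) \<Rightarrow> bool" where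
  "coxeter_matrix S M \<longleftrightarrow>
     (\<forall>s\<in>S. M s s = 1) \<and>
     (\<forall>s\<in>S. \<forall>t\<in>S. M s t = M t s) \<and>
     (\<forall>s\<in>S. \<forall>t\<in>S. s \<noteq> t \<longrightarrow> M s t \<noteq> 1)"

text \<open>Group words over \<open>S\<close> are lists of signed letters; \<open>(s, True)\<close> stands for \<open>s\<close> and
  \<open>(s, False)\<close> for its formal inverse. The following is the congruence on such words whose
  quotient is the group presented by generators \<open>S\<close> and relators \<open>(s t)\<^bsup>M s t\<^esup>\<close>.
  For \<open>M s t = 0\<close> the relator is the empty word and imposes nothing.\<close>

inductive coxeter_equiv ::
  "'a set \<Rightarrow> ('a \<Rightarrow> 'a \<Rightarrow> nat) \<Rightarrow> ('a \<times> bool) list \<Rightarrow> ('a \<times> bool) list \<Rightarrow> bool"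
  for S :: "'a set" and M :: "'a \<Rightarrow> 'a \<Rightarrow> nat" where
  refl: "w \<in> lists (S \<times> UNIV) \<Longrightarrow> coxeter_equiv S M w w"
| sym: "coxeter_equiv S M v w \<Longrightarrow> coxeter_equiv S M w v"
| trans: "coxeter_equiv S M u v \<Longrightarrow> coxeter_equiv S M v w \<Longrightarrow> coxeter_equiv S M u w"
| cancel: "u \<in> lists (S \<times> UNIV) \<Longrightarrow> v \<in> lists (S \<times> UNIV) \<Longrightarrow> s \<in> S \<Longrightarrow>
    coxeter_equiv S M (u @ [(s, b), (s, \<not> b)] @ v) (u @ v)"
| relator: "u \<in> lists (S \<times> UNIV) \<Longrightarrow> v \<in> lists (S \<times> UNIV) \<Longrightarrow> s \<in> S \<Longrightarrow> t \<in> S \<Longrightarrow>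
    coxeter_equiv S M (u @ concat (replicate (M s t) [(s, True), (t, True)]) @ v) (u @ v)"

definition word_prod :: "('a, 'b) monoid_scheme \<Rightarrow> 'a list \<Rightarrow> 'a" where
  "word_prod G w = foldr (\<otimes>\<^bsub>G\<^esub>) w \<one>\<^bsub>G\<^esub>"

definition eval_signed :: "('a, 'b) monoid_scheme \<Rightarrow> ('a \<times> bool) list \<Rightarrow> 'a" where
  "eval_signed G w = word_prod G (map (\<lambda>(s, b). if b then s else inv\<^bsub>G\<^esub> s) w)"

text \<open>\<open>G\<close> is a Coxeter group with set of simple reflections \<open>S\<close>: the canonical map from
  group words over \<open>S\<close> to \<open>G\<close> is onto and identifies \<open>G\<close> with the presented group.\<close>

definition coxeter_system :: "('a, 'b) monoid_scheme \<Rightarrow> 'a set \<Rightarrow> bool" where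
  "coxeter_system G S \<longleftrightarrow>
     group G \<and> S \<subseteq> carrier G \<and> generate G S = carrier G \<and>
     (\<exists>M. coxeter_matrix S M \<and>
       (\<forall>v\<in>lists (S \<times> UNIV). \<forall>w\<in>lists (S \<times> UNIV).
          eval_signed G v = eval_signed G w \<longleftrightarrow> coxeter_equiv S M v w))"

definition coxeter_length :: "('a, 'b) monoid_scheme \<Rightarrow> 'a set \<Rightarrow> 'a \<Rightarrow> nat" where
  "coxeter_length G S g = (LEAST n. \<exists>w\<in>lists S. length w = n \<and> word_prod G w = g)"

definition reduced_expression ::
  "('a, 'b) monoid_scheme \<Rightarrow> 'a set \<Rightarrow> 'a list \<Rightarrow> 'a \<Rightarrow> bool" where
  "reduced_expression G S w g \<longleftrightarrow>
     w \<in> lists S \<and> word_prod G w = g \<and> length w = coxeter_length G S g"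

definition demazure_product :: "('a, 'b) monoid_scheme \<Rightarrow> 'a set \<Rightarrow> 'a list \<Rightarrow> 'a" where
  "demazure_product G S Q =
     foldl (\<lambda>d s. if coxeter_length G S (d \<otimes>\<^bsub>G\<^esub> s) > coxeter_length G S d
                  then d \<otimes>\<^bsub>G\<^esub> s else d) \<one>\<^bsub>G\<^esub> Q"


section \<open>Subword complexes\<close>

text \<open>Positions in a word of length \<open>m\<close>, and likewise the variables of the polynomial ring
  below, are indexed by \<open>{..<m}\<close> rather than by \<open>{1..m}\<close>.\<close>

definition subword_facets ::
  "('a, 'b) monoid_scheme \<Rightarrow> 'a set \<Rightarrow> 'a list \<Rightarrow> 'a \<Rightarrow> nat set set" where
  "subword_facets G S Q g =
     {F. F \<subseteq> {..<length Q} \<and> reduced_expression G S (nths Q ({..<length Q} - F)) g}"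

definition subword_complex ::
  "('a, 'b) monoid_scheme \<Rightarrow> 'a set \<Rightarrow> 'a list \<Rightarrow> 'a \<Rightarrow> nat set set" where
  "subword_complex G S Q g = {A. \<exists>F\<in>subword_facets G S Q g. A \<subseteq> F}"


section \<open>Graded quotients of polynomial rings over the complex numbers\<close>

text \<open>A polynomial is a finitely supported map from exponent vectors to coefficients.\<close>

type_synonym cpoly = "(nat \<Rightarrow>\<^sub>0 nat) \<Rightarrow>\<^sub>0 complex"

definition cpoly_var :: "nat \<Rightarrow> cpoly" where
  "cpoly_var i = Poly_Mapping.single (Poly_Mapping.single i 1) 1"

definition cpoly_const :: "complex \<Rightarrow> cpoly" where
  "cpoly_const c = Poly_Mapping.single 0 c"

definition cpoly_ring :: "nat \<Rightarrow> cpoly ring" where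
  "cpoly_ring m =
     \<lparr>carrier = {p. \<forall>a\<in>Poly_Mapping.keys p. Poly_Mapping.keys a \<subseteq> {..<m}},
      mult = (*), one = 1, zero = 0, add = (+)\<rparr>"

definition homogeneous_part :: "nat \<Rightarrow> nat \<Rightarrow> cpoly set" where
  "homogeneous_part m k =
     {p \<in> carrier (cpoly_ring m). \<forall>a\<in>Poly_Mapping.keys p.
        (\<Sum>i\<in>Poly_Mapping.keys a. Poly_Mapping.lookup a i) = k}"

text \<open>The quotient by \<open>I\<close> as a complex algebra; scalars act through the classes of the
  constant polynomials.\<close>

definition quotient_algebra :: "nat \<Rightarrow> cpoly set \<Rightarrow> (complex, cpoly set) module" where
  "quotient_algebra m I = (let R = cpoly_ring m Quot I in
     \<lparr>carrier = carrier R, mult = mult R, one = one R, zero = zero R, add = add R,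
      smult = (\<lambda>c X. (I +>\<^bsub>cpoly_ring m\<^esub> cpoly_const c) \<otimes>\<^bsub>R\<^esub> X)\<rparr>)"

text \<open>The component of degree \<open>k\<close> of the quotient, for homogeneous \<open>I\<close>. Only the additive
  structure and the scalar action are meaningful here; the fields \<open>mult\<close> and \<open>one\<close> of the
  record are carried along.\<close>

definition graded_component ::
  "nat \<Rightarrow> cpoly set \<Rightarrow> nat \<Rightarrow> (complex, cpoly set) module" where
  "graded_component m I k = (quotient_algebra m I)
     \<lparr>carrier := (\<lambda>p. I +>\<^bsub>cpoly_ring m\<^esub> p) ` homogeneous_part m k\<rparr>"

definition hilbert_function :: "nat \<Rightarrow> cpoly set \<Rightarrow> nat \<Rightarrow> nat" where
  "hilbert_function m I k = vectorspace.dim class_ring (graded_component m I k)"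

definition hilbert_polynomial :: "nat \<Rightarrow> cpoly set \<Rightarrow> real poly" where
  "hilbert_polynomial m I =
     (THE p. \<exists>N. \<forall>k\<ge>N. real (hilbert_function m I k) = poly p (real k))"

text \<open>\<open>hilbertian m I\<close> says that the quotient of the polynomial ring in \<open>m\<close> variables by the
  homogeneous ideal \<open>I\<close> is Hilbertian.\<close>

definition hilbertian :: "nat \<Rightarrow> cpoly set \<Rightarrow> bool" where
  "hilbertian m I \<longleftrightarrow>
     (\<forall>k. real (hilbert_function m I k) = poly (hilbert_polynomial m I) (real k))"

text \<open>The empty family of faces (as opposed to \<open>{{}}\<close>) gives the unit ideal.\<close>

definition stanley_reisner_ideal :: "nat \<Rightarrow> nat set set \<Rightarrow> cpoly set" where
  "stanley_reisner_ideal m \<Delta> =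
     Idl\<^bsub>cpoly_ring m\<^esub> {\<Prod>i\<in>\<tau>. cpoly_var i | \<tau>. \<tau> \<subseteq> {..<m} \<and> \<tau> \<notin> \<Delta>}"

end

theory Submission
  imports Defs "HOL-Library.Sublist"
begin

text \<open>
  Both sides of the equivalence are read off one number, the alternating sum
  \<open>\<Sum>F\<in>\<Delta>. (-1) ^ card F\<close> over all faces of the complex, the empty one included.

  \<^bold>\<open>Algebra.\<close> The Stanley--Reisner ideal consists of the polynomials all of whose monomials have
  a non-face as support (\<open>stanley_reisner_ideal_eq\<close>), so the classes of the monomials of degree \<open>k\<close>
  whose support is a face are a basis of the component of degree \<open>k\<close>
  (\<open>hilbert_function_nonface_polys\<close>). For \<open>k > 0\<close> a face with \<open>n > 0\<close> elements is the support of
  \<open>(k - 1) choose (n - 1)\<close> of them. This is polynomial in \<open>k\<close>, and the polynomial has the value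
  \<open>- (-1) ^ n\<close> at \<open>0\<close>, where the true count is \<open>0\<close>; for the empty face the polynomial is \<open>0\<close> and the
  true count at \<open>0\<close> is \<open>1\<close>. In either case the defect at \<open>k = 0\<close> is \<open>(-1) ^ n\<close>, so
  Hilbert function and Hilbert polynomial agree for \<open>k > 0\<close> and differ at \<open>k = 0\<close> by
  exactly the alternating sum (\<open>hilbertian_iff\<close>).

  \<^bold>\<open>Coxeter groups.\<close> A set \<open>F\<close> of positions is a face iff the word left after deleting \<open>F\<close> contains a
  reduced expression of \<open>\<pi>\<close>. Splitting the faces according to whether they contain the last
  position of \<open>Q = Q' s\<close> (deletion and link of a vertex) gives a recursion for the alternating sum.
  If \<open>\<pi> s\<close> is longer than \<open>\<pi>\<close>, no reduced expression of \<open>\<pi>\<close> ends in \<open>s\<close>, the complex is a cone over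
  the last position, and the sum vanishes. If \<open>\<pi> s\<close> is shorter, the exchange property shows that
  \<open>w s\<close> contains a reduced expression of \<open>\<pi>\<close> iff \<open>w\<close> contains one of \<open>\<pi> s\<close>, so the deletion is the
  complex of \<open>(Q', \<pi> s)\<close> and the link that of \<open>(Q', \<pi>)\<close>. As \<open>\<delta>(Q')\<close> is equal to at most one of \<open>\<pi>\<close> and \<open>\<pi> s\<close>, at most one of the
  two sums is non-zero by induction, and one is iff \<open>\<delta>(Q) = \<pi>\<close> (\<open>alternating_sum_nonzero_iff\<close>).

  The exchange property is derived from the presentation (\<open>exchange\<close>): the parity of the
  number of times a reflection occurs among the reflections attached to a word depends on
  the value of the word only.
\<close>

section \<open>The exchange property\<close>

text \<open>Cancellations and relators have even length. Hence multiplication by a simple reflection always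
  changes the length of a group element (\<open>len_mult_neq\<close>).\<close>

lemma coxeter_equiv_parity: "coxeter_equiv S M v w \<Longrightarrow> even (length v) \<longleftrightarrow> even (length w)"
proof (induction rule: coxeter_equiv.induct)
  case (relator u v s t)
  have "length (concat (replicate n [(s, True), (t, True)])) = 2 * n" for n
    by (induction n) auto
  then show ?case by simp
qed auto

locale coxeter_group = group G for G (structure) +
  fixes S
  assumes coxeter: "coxeter_system G S"
begin

abbreviation "val \<equiv> word_prod G"
abbreviation "len \<equiv> coxeter_length G S"
abbreviation "reduced \<equiv> reduced_expression G S"

lemma S_carrier [simp]: "s \<in> S \<Longrightarrow> s \<in> carrier G"
  using coxeter by (auto simp: coxeter_system_def)

lemma val_Nil [simp]: "val [] = \<one>" and val_Cons [simp]: "val (s # w) = s \<otimes> val w"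
  by (simp_all add: word_prod_def)

lemma val_closed [simp]: "w \<in> lists S \<Longrightarrow> val w \<in> carrier G"
  by (induction w) auto

lemma val_append [simp]:
  "u \<in> lists S \<Longrightarrow> v \<in> lists S \<Longrightarrow> val (u @ v) = val u \<otimes> val v"
  by (induction u) (auto simp: m_assoc)

lemma eval_equiv:
  obtains M where "coxeter_matrix S M"
    "\<And>v w. v \<in> lists (S \<times> UNIV) \<Longrightarrow> w \<in> lists (S \<times> UNIV) \<Longrightarrow>
       eval_signed G v = eval_signed G w \<longleftrightarrow> coxeter_equiv S M v w"
  using coxeter unfolding coxeter_system_def by blast

lemma S_square [simp]:
  assumes "s \<in> S" shows "s \<otimes> s = \<one>"
proof -
  obtain M where M: "coxeter_matrix S M" and
    eq: "\<And>v w. v \<in> lists (S \<times> UNIV) \<Longrightarrow> w \<in> lists (S \<times> UNIV) \<Longrightarrow>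
       eval_signed G v = eval_signed G w \<longleftrightarrow> coxeter_equiv S M v w"
    using eval_equiv by metis
  have "M s s = 1" using M assms by (simp add: coxeter_matrix_def)
  then have "coxeter_equiv S M [(s, True), (s, True)] []"
    using coxeter_equiv.relator[of "[]" S "[]" s s M] assms by simp
  with eq[of "[(s, True), (s, True)]" "[]"] assms show ?thesis
    by (simp add: eval_signed_def)
qed

lemma S_cancel [simp]:
  assumes "s \<in> S" "g \<in> carrier G"
  shows "s \<otimes> (s \<otimes> g) = g" "g \<otimes> s \<otimes> s = g"
  using assms by (simp_all add: m_assoc[symmetric]) (simp add: m_assoc)

lemma S_inv [simp]: "s \<in> S \<Longrightarrow> inv s = s"
  by (rule inv_equality) auto

lemma eval_signed_eq: "w \<in> lists (S \<times> UNIV) \<Longrightarrow> eval_signed G w = val (map fst w)"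
  by (induction w) (auto simp: eval_signed_def)

text \<open>A letter \<open>s\<close> of a word, followed by the suffix \<open>w\<close>, has the associated reflection
  \<open>w\<inverse> s w\<close>: multiplying the word by it from the right deletes the letter. The function counts
  how often \<open>r\<close> is associated with a letter.\<close>

primrec refl_count :: "'a list \<Rightarrow> 'a \<Rightarrow> nat" where
  "refl_count [] r = 0"
| "refl_count (s # w) r =
     (if inv (val w) \<otimes> s \<otimes> val w = r then 1 else 0) + refl_count w r"

text \<open>Appending \<open>v\<close> conjugates the reflections of \<open>u\<close> by the value of \<open>v\<close>. So the effect of a local
  change of a word on these counts depends only on the counts and the value of the changed part.\<close>

lemma refl_count_append:
  assumes "u \<in> lists S" "v \<in> lists S" "r \<in> carrier G"
  shows "refl_count (u @ v) r = refl_count u (val v \<otimes> r \<otimes> inv (val v)) + refl_count v r"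
  using assms(1)
proof (induction u)
  case (Cons s u)
  have "inv (val (u @ v)) \<otimes> s \<otimes> val (u @ v) = r \<longleftrightarrow>
        inv (val u) \<otimes> s \<otimes> val u = val v \<otimes> r \<otimes> inv (val v)" (is "?l = r \<longleftrightarrow> ?c = _")
  proof -
    have c: "?c \<in> carrier G" using Cons.hyps by auto
    have "?l = inv (val v) \<otimes> ?c \<otimes> val v"
      using Cons assms by (auto simp: inv_mult_group m_assoc)
    moreover have "inv (val v) \<otimes> ?c \<otimes> val v = r \<longleftrightarrow> ?c = val v \<otimes> r \<otimes> inv (val v)"
      using c assms(2,3) inv_solve_left'[of r "val v" "?c \<otimes> val v"]
        inv_solve_right[of ?c "val v \<otimes> r" "val v"] by (simp add: m_assoc) metis
    ultimately show ?thesis by simp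
  qed
  with Cons show ?case by auto
qed simp

text \<open>With \<open>d = t s\<close>, the reflections of \<open>(s t)\<^bsup>n\<^esup>\<close>, read from the right, are \<open>d\<^bsup>j\<^esup> t\<close> for
  \<open>j < 2 n\<close>. If \<open>(s t)\<^bsup>n\<^esup> = 1\<close>, then \<open>d\<^bsup>n\<^esup> = 1\<close> and the second half of this list repeats the first.\<close>

lemma refl_count_relator:
  assumes st: "s \<in> S" "t \<in> S" and one: "val (concat (replicate n [s, t])) = \<one>"
  shows "even (refl_count (concat (replicate n [s, t])) r)"
proof -
  let ?w = "\<lambda>n. concat (replicate n [s, t])"
  define d where "d = t \<otimes> s"
  have d: "d \<in> carrier G" using st by (simp add: d_def)
  have w: "?w n \<in> lists S" for n using st by (induction n) auto
  have val_w: "val (?w n) = inv (d [^] n)" for n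
  proof (induction n)
    case (Suc n)
    have "val (?w (Suc n)) = (s \<otimes> t) \<otimes> inv (d [^] n)"
      using Suc st d by (simp add: m_assoc)
    also have "s \<otimes> t = inv d" using st by (simp add: d_def inv_mult_group)
    also have "inv d \<otimes> inv (d [^] n) = inv (d [^] Suc n)"
      using d by (simp add: inv_mult_group)
    finally show ?case .
  qed simp
  have conj: "t \<otimes> inv (d [^] n) = d [^] n \<otimes> t" for n :: nat
  proof (induction n)
    case (Suc n)
    have "inv (d [^] Suc n) = inv d \<otimes> inv (d [^] n)" using d by (simp add: inv_mult_group)
    also have "inv d = s \<otimes> t" using st by (simp add: d_def inv_mult_group)
    finally have "t \<otimes> inv (d [^] Suc n) = d \<otimes> (t \<otimes> inv (d [^] n))"
      using st d by (simp add: d_def m_assoc)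
    also have "\<dots> = d [^] Suc n \<otimes> t"
      using Suc st d by (simp add: m_assoc[symmetric] nat_pow_Suc2[symmetric] del: nat_pow_Suc)
    finally show ?case .
  qed (use st in simp)
  have odd_refl: "inv (val (?w n)) \<otimes> t \<otimes> val (?w n) = d [^] (2 * n) \<otimes> t" for n
    using st d by (simp add: val_w m_assoc conj) (simp add: m_assoc[symmetric] nat_pow_mult mult_2)
  have even_refl: "inv (val (t # ?w n)) \<otimes> s \<otimes> val (t # ?w n) = d [^] Suc (2 * n) \<otimes> t" for n
  proof -
    have "inv (val (t # ?w n)) \<otimes> s \<otimes> val (t # ?w n)
        = d [^] n \<otimes> (d \<otimes> (t \<otimes> inv (d [^] n)))"
      using st d w[of n] by (simp add: val_w inv_mult_group m_assoc d_def)
    also have "\<dots> = d [^] n \<otimes> d [^] Suc n \<otimes> t"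
      unfolding conj using st d
      by (simp add: m_assoc[symmetric] nat_pow_Suc2[symmetric] del: nat_pow_Suc)
    also have "d [^] n \<otimes> d [^] Suc n = d [^] Suc (2 * n)"
      using nat_pow_mult[OF d, of n "Suc n"] by (simp add: mult_2 del: nat_pow_Suc)
    finally show ?thesis .
  qed
  have count: "refl_count (?w n) r = (\<Sum>j<2 * n. if d [^] j \<otimes> t = r then 1 else 0)" for n
    by (induction n) (simp_all add: odd_refl even_refl del: val_Cons nat_pow_Suc)
  have split: "(\<Sum>j<m + n. f j) = (\<Sum>j<m. f j) + (\<Sum>j<n. f (m + j))" for m n and f :: "nat \<Rightarrow> nat"
    by (induction n) auto
  have dn: "d [^] n = \<one>" using one d by (simp add: val_w inv_eq_1_iff)
  have "(\<Sum>j<2 * n. if d [^] j \<otimes> t = r then 1 else (0::nat))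
      = (\<Sum>j<n. if d [^] j \<otimes> t = r then 1 else 0) + (\<Sum>j<n. if d [^] (n + j) \<otimes> t = r then 1 else 0)"
    by (simp add: mult_2 split)
  moreover have "d [^] (n + j) = d [^] j" for j using d dn by (simp add: nat_pow_mult[symmetric])
  ultimately show ?thesis by (simp add: count)
qed

text \<open>The step at which the presentation enters: the inserted or deleted words have value \<open>1\<close> and
  even counts, and a word of value \<open>1\<close> does not conjugate the reflections to its left.\<close>

lemma coxeter_equiv_refl_count:
  assumes "\<And>s t. s \<in> S \<Longrightarrow> t \<in> S \<Longrightarrow> val (concat (replicate (M s t) [s, t])) = \<one>"
    and "coxeter_equiv S M v w" "r \<in> carrier G"
  shows "even (refl_count (map fst v) r) \<longleftrightarrow> even (refl_count (map fst w) r)"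
  using assms(2)
proof (induction rule: coxeter_equiv.induct)
  case (cancel u v s b)
  then have "map fst u \<in> lists S" "map fst v \<in> lists S" by (auto simp: in_lists_conv_set)
  with cancel \<open>r \<in> carrier G\<close> show ?case
    by (simp add: refl_count_append m_assoc inv_mult_group)
next
  case (relator u v s t)
  let ?x = "concat (replicate (M s t) [s, t])"
  have eq: "map fst (concat (replicate n [(s, True), (t, True)])) = concat (replicate n [s, t])" for n
    by (induction n) auto
  have x: "concat (replicate n [s, t]) \<in> lists S" for n
    using relator by (induction n) auto
  have "map fst u \<in> lists S" "map fst v \<in> lists S" using relator by (auto simp: in_lists_conv_set)
  with relator \<open>r \<in> carrier G\<close> x[of "M s t"] assms(1)[of s t] show ?case
    by (simp add: refl_count_append eq refl_count_relator)
qed auto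

lemma val_eq_equiv:
  obtains M where "\<And>s t. s \<in> S \<Longrightarrow> t \<in> S \<Longrightarrow> val (concat (replicate (M s t) [s, t])) = \<one>"
    "\<And>v w. v \<in> lists S \<Longrightarrow> w \<in> lists S \<Longrightarrow> val v = val w \<Longrightarrow>
       coxeter_equiv S M (map (\<lambda>s. (s, True)) v) (map (\<lambda>s. (s, True)) w)"
proof -
  obtain M where
    eq: "\<And>v w. v \<in> lists (S \<times> UNIV) \<Longrightarrow> w \<in> lists (S \<times> UNIV) \<Longrightarrow>
       eval_signed G v = eval_signed G w \<longleftrightarrow> coxeter_equiv S M v w"
    using eval_equiv by metis
  show ?thesis
  proof (rule that[of M])
    fix s t assume st: "s \<in> S" "t \<in> S"
    let ?x = "\<lambda>n. concat (replicate n [(s, True), (t, True)])"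
    have x: "?x n \<in> lists (S \<times> UNIV)" "map fst (?x n) = concat (replicate n [s, t])" for n
      using st by (induction n) auto
    have "coxeter_equiv S M (?x (M s t)) []"
      using coxeter_equiv.relator[of "[]" S "[]" s t M] st by simp
    then have "eval_signed G (?x (M s t)) = eval_signed G []"
      using x(1)[of "M s t"] by (subst eq) auto
    then show "val (concat (replicate (M s t) [s, t])) = \<one>"
      using eval_signed_eq[OF x(1)[of "M s t"]] x(2)[of "M s t"] by (simp add: eval_signed_def)
  next
    fix v w assume vw: "v \<in> lists S" "w \<in> lists S" "val v = val w"
    have "map (\<lambda>s. (s, True)) u \<in> lists (S \<times> UNIV)" if "u \<in> lists S" for u
      using that by auto
    with vw show "coxeter_equiv S M (map (\<lambda>s. (s, True)) v) (map (\<lambda>s. (s, True)) w)"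
      by (subst eq[symmetric]) (auto simp: eval_signed_eq comp_def)
  qed
qed

lemma val_eq_parity:
  assumes "v \<in> lists S" "w \<in> lists S" "val v = val w"
  shows "even (length v) \<longleftrightarrow> even (length w)"
  using val_eq_equiv coxeter_equiv_parity assms by (metis length_map)

lemma val_eq_refl_count:
  assumes "v \<in> lists S" "w \<in> lists S" "val v = val w" "r \<in> carrier G"
  shows "even (refl_count v r) \<longleftrightarrow> even (refl_count w r)"
proof -
  obtain M where M: "\<And>s t. s \<in> S \<Longrightarrow> t \<in> S \<Longrightarrow> val (concat (replicate (M s t) [s, t])) = \<one>"
    "coxeter_equiv S M (map (\<lambda>s. (s, True)) v) (map (\<lambda>s. (s, True)) w)"
    using val_eq_equiv assms(1-3) by metis
  from coxeter_equiv_refl_count[OF M assms(4)] show ?thesis by (simp add: comp_def)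
qed

text \<open>If \<open>r\<close> is the reflection associated with a letter of \<open>w\<close>, deleting that letter
  multiplies the value by \<open>r\<close>.\<close>

lemma refl_count_delete:
  assumes "w \<in> lists S" "r \<in> carrier G" "refl_count w r > 0"
  shows "\<exists>v. subseq v w \<and> Suc (length v) = length w \<and> val v = val w \<otimes> r"
  using assms(1,3)
proof (induction w)
  case (Cons s w)
  show ?case
  proof (cases "inv (val w) \<otimes> s \<otimes> val w = r")
    case True
    have "val (s # w) \<otimes> r = val w"
      unfolding True[symmetric] using Cons.hyps
      by (simp add: m_assoc[symmetric]) (simp add: m_assoc)
    then show ?thesis by (intro exI[of _ w]) auto
  next
    case False
    with Cons obtain v where "subseq v w" "Suc (length v) = length w" "val v = val w \<otimes> r"
      by auto
    then show ?thesis using Cons.hyps assms(2) by (intro exI[of _ "s # v"]) (auto simp: m_assoc)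
  qed
qed simp

lemma subseq_lists: "subseq v w \<Longrightarrow> w \<in> lists S \<Longrightarrow> v \<in> lists S"
  by (auto simp: in_lists_conv_set elim!: list_emb_set)

lemma val_surj:
  assumes "g \<in> carrier G" shows "\<exists>w\<in>lists S. val w = g"
proof -
  have "g \<in> generate G S" using assms coxeter by (simp add: coxeter_system_def)
  then show ?thesis
  proof (induction rule: generate.induct)
    case one show ?case by (rule bexI[of _ "[]"]) auto
  next
    case (incl h) then show ?case by (intro bexI[of _ "[h]"]) auto
  next
    case (inv h) then show ?case by (intro bexI[of _ "[h]"]) auto
  next
    case (eng h1 h2)
    then obtain u v where "u \<in> lists S" "v \<in> lists S" "val u = h1" "val v = h2" by blast
    then show ?case by (intro bexI[of _ "u @ v"]) auto
  qed
qed

lemma reduced_exists: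
  assumes "g \<in> carrier G" shows "\<exists>w. reduced w g"
proof -
  have "\<exists>n. \<exists>w\<in>lists S. length w = n \<and> val w = g" using val_surj[OF assms] by auto
  from LeastI_ex[OF this] show ?thesis
    unfolding reduced_expression_def coxeter_length_def by blast
qed

lemma len_le: "w \<in> lists S \<Longrightarrow> len (val w) \<le> length w"
  unfolding coxeter_length_def by (rule Least_le) auto

lemma len_one: "len \<one> = 0"
  using len_le[of "[]"] by simp

lemma len_mult_le: "g \<in> carrier G \<Longrightarrow> s \<in> S \<Longrightarrow> len (g \<otimes> s) \<le> Suc (len g)"
proof -
  assume g: "g \<in> carrier G" and s: "s \<in> S"
  then obtain w where "reduced w g" using reduced_exists by blast
  then show ?thesis using len_le[of "w @ [s]"] s by (auto simp: reduced_expression_def)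
qed

lemma len_mult_neq:
  assumes g: "g \<in> carrier G" and s: "s \<in> S" shows "len (g \<otimes> s) \<noteq> len g"
proof -
  obtain w v where w: "reduced w g" and v: "reduced v (g \<otimes> s)"
    using reduced_exists g s by (metis S_carrier m_closed)
  have "even (length (w @ [s])) \<longleftrightarrow> even (length v)"
    using w v s by (intro val_eq_parity) (auto simp: reduced_expression_def)
  then show ?thesis using w v by (auto simp: reduced_expression_def)
qed

lemma len_descent:
  assumes "g \<in> carrier G" "s \<in> S" "len (g \<otimes> s) < len g"
  shows "len g = Suc (len (g \<otimes> s))"
  using len_mult_le[of "g \<otimes> s" s] assms by simp

text \<open>If \<open>s\<close> occurred an even number of times among the reflections of \<open>w\<close>, it would occur an odd
  number of times for \<open>w @ [s]\<close>, where \<open>s\<close> itself is added, and hence for every word with the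
  same value. A reduced one could then be shortened by a letter to a word for the value of \<open>w\<close>, so
  multiplication by \<open>s\<close> would increase the length. Hence \<open>s\<close> is a reflection of \<open>w\<close>, and the
  corresponding letter can be deleted.\<close>

lemma exchange:
  assumes w: "w \<in> lists S" and s: "s \<in> S" and less: "len (val w \<otimes> s) < len (val w)"
  shows "\<exists>v. subseq v w \<and> Suc (length v) = length w \<and> val v = val w \<otimes> s"
proof -
  have "odd (refl_count w s)"
  proof (rule ccontr)
    assume even: "\<not> odd (refl_count w s)"
    obtain u where u: "reduced u (val w \<otimes> s)" using reduced_exists w s by (metis S_carrier m_closed val_closed)
    have "refl_count (w @ [s]) s = refl_count w s + 1"
      using w s by (simp add: refl_count_append)
    then have "odd (refl_count u s)"
      using even val_eq_refl_count[of u "w @ [s]" s] u w s by (auto simp: reduced_expression_def)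
    then have "refl_count u s > 0" by (rule odd_pos)
    then obtain v where v: "subseq v u" "Suc (length v) = length u" "val v = val w \<otimes> s \<otimes> s"
      using refl_count_delete[of u s] u s by (auto simp: reduced_expression_def)
    then have "len (val w) \<le> length v"
      using len_le[of v] subseq_lists[of v u] u w s by (auto simp: reduced_expression_def)
    then show False using v u less by (auto simp: reduced_expression_def)
  qed
  then have "refl_count w s > 0" by (rule odd_pos)
  then show ?thesis using refl_count_delete w s by simp
qed

section \<open>Alternating sums over subwords and the Demazure product\<close>

text \<open>By the subword property this relation says that \<open>g\<close> lies below the Demazure product of \<open>w\<close> in the
  Bruhat order. It is used in place of that order.\<close>

definition contains_reduced :: "'a list \<Rightarrow> 'a \<Rightarrow> bool" where
  "contains_reduced w g \<longleftrightarrow> (\<exists>v. subseq v w \<and> reduced v g)"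

lemma subseq_snoc_iff:
  "subseq v (w @ [s]) \<longleftrightarrow> subseq v w \<or> (\<exists>u. v = u @ [s] \<and> subseq u w)"
proof
  assume "subseq v (w @ [s])"
  then obtain a b where "v = a @ b" "subseq a w" "subseq b [s]"
    by (auto elim: subseq_appendE)
  then show "subseq v w \<or> (\<exists>u. v = u @ [s] \<and> subseq u w)"
    by (cases b) (auto split: if_splits)
qed (auto intro: subseq_rev_drop_many)

lemma reduced_snoc:
  assumes "g \<in> carrier G" "s \<in> S"
  shows "reduced (u @ [s]) g \<longleftrightarrow> reduced u (g \<otimes> s) \<and> len (g \<otimes> s) < len g"
proof
  assume r: "reduced (u @ [s]) g"
  then have uS: "u \<in> lists S" and g: "g = val (u @ [s])"
    by (auto simp: reduced_expression_def)
  have u: "u \<in> lists S" "val u = g \<otimes> s"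
    unfolding g using uS assms(2) by simp_all
  then show "reduced u (g \<otimes> s) \<and> len (g \<otimes> s) < len g"
    using r len_le[of u] len_mult_le[of "g \<otimes> s" s] assms by (auto simp: reduced_expression_def)
next
  assume "reduced u (g \<otimes> s) \<and> len (g \<otimes> s) < len g"
  then show "reduced (u @ [s]) g" using assms len_descent[of g s] by (auto simp: reduced_expression_def)
qed

lemma contains_reduced_snoc_ascent:
  assumes "g \<in> carrier G" "s \<in> S" "len g < len (g \<otimes> s)"
  shows "contains_reduced (w @ [s]) g \<longleftrightarrow> contains_reduced w g"
  using assms by (auto simp: contains_reduced_def subseq_snoc_iff reduced_snoc)

text \<open>If a reduced expression of \<open>g\<close> uses the last letter, dropping that letter gives one of \<open>g s\<close>;
  if it lies in \<open>w\<close>, the exchange property deletes another of its letters to the same effect.\<close>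

lemma contains_reduced_snoc_descent:
  assumes "g \<in> carrier G" "s \<in> S" "len (g \<otimes> s) < len g"
  shows "contains_reduced (w @ [s]) g \<longleftrightarrow> contains_reduced w (g \<otimes> s)"
proof
  assume "contains_reduced (w @ [s]) g"
  then obtain v where v: "subseq v (w @ [s])" "reduced v g" by (auto simp: contains_reduced_def)
  show "contains_reduced w (g \<otimes> s)"
  proof (cases "subseq v w")
    case True
    obtain u where u: "subseq u v" "Suc (length u) = length v" "val u = g \<otimes> s"
      using exchange[of v s] v assms by (auto simp: reduced_expression_def)
    moreover have "reduced u (g \<otimes> s)"
      using u v len_descent[OF assms] subseq_lists[of u v] by (auto simp: reduced_expression_def)
    ultimately show ?thesis using True subseq_order.trans by (auto simp: contains_reduced_def)
  next
    case False
    then show ?thesis using v assms by (auto simp: subseq_snoc_iff reduced_snoc contains_reduced_def)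
  qed
next
  assume "contains_reduced w (g \<otimes> s)"
  then show "contains_reduced (w @ [s]) g"
    using assms by (auto simp: contains_reduced_def subseq_snoc_iff reduced_snoc)
qed

abbreviation "demazure \<equiv> demazure_product G S"

lemma demazure_Nil: "demazure [] = \<one>" by (simp add: demazure_product_def)

lemma demazure_snoc:
  "demazure (Q @ [s]) =
     (if len (demazure Q \<otimes> s) > len (demazure Q) then demazure Q \<otimes> s else demazure Q)"
  by (simp add: demazure_product_def)

lemma demazure_closed: "Q \<in> lists S \<Longrightarrow> demazure Q \<in> carrier G"
proof (induction Q rule: rev_induct)
  case (snoc s Q) then show ?case unfolding demazure_snoc by auto
qed (simp add: demazure_Nil)

text \<open>The sum runs over the sets \<open>A\<close> of positions that are kept, the complements of the faces; up to the
  sign \<open>(-1)\<^bsup>length Q\<^esup>\<close> it is the alternating sum over the faces (\<open>sum_subword_complex\<close>).\<close>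

definition alternating_sum :: "'a list \<Rightarrow> 'a \<Rightarrow> int" where
  "alternating_sum Q g = (\<Sum>A | A \<subseteq> {..<length Q} \<and> contains_reduced (nths Q A) g. (-1) ^ card A)"

lemma alternating_sum_eq_if:
  "alternating_sum Q g = (\<Sum>A\<in>Pow {..<length Q}. if contains_reduced (nths Q A) g then (-1) ^ card A else 0)"
  unfolding alternating_sum_def by (subst sum.inter_filter[symmetric]) (auto intro: sum.cong)

text \<open>The position sets that omit the last position contribute the sum for \<open>Q\<close>, those that keep it
  the subtracted sum. In terms of faces these are the link and the deletion of the last position.\<close>

lemma alternating_sum_snoc:
  "alternating_sum (Q @ [s]) g = alternating_sum Q g
     - (\<Sum>A\<in>Pow {..<length Q}. if contains_reduced (nths Q A @ [s]) g then (-1) ^ card A else 0)"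
proof -
  let ?n = "length Q"
  let ?f = "\<lambda>A. if contains_reduced (nths (Q @ [s]) A) g then (-1) ^ card A else (0::int)"
  \<comment> \<open>Membership of the last position \<open>?n\<close> in the index set does not affect \<open>nths Q\<close>.\<close>
  have nths_snoc: "nths (Q @ [s]) A = nths Q A" "nths (Q @ [s]) (insert ?n A) = nths Q A @ [s]"
    and card: "card (insert ?n A) = Suc (card A)" if "A \<in> Pow {..<?n}" for A
  proof -
    have "?n \<notin> A" "finite A" using that finite_subset by auto
    moreover have "nths Q (insert ?n A) = nths Q A"
      unfolding nths_def by (rule arg_cong[where f = "map fst"], rule filter_cong) (auto simp: set_zip)
    ultimately show "nths (Q @ [s]) A = nths Q A" "nths (Q @ [s]) (insert ?n A) = nths Q A @ [s]"
      "card (insert ?n A) = Suc (card A)"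
      by (simp_all add: nths_append)
  qed
  have inj: "inj_on (insert ?n) (Pow {..<?n})"
    by (auto simp: inj_on_def) (metis insert_ident lessThan_iff less_irrefl subsetD)+
  have "alternating_sum (Q @ [s]) g = sum ?f (Pow {..<?n}) + sum ?f (insert ?n ` Pow {..<?n})"
    unfolding alternating_sum_eq_if
    by (simp add: lessThan_Suc Pow_insert) (rule sum.union_disjoint, auto)
  also have "sum ?f (Pow {..<?n}) = alternating_sum Q g"
    unfolding alternating_sum_eq_if by (intro sum.cong) (simp_all add: nths_snoc)
  also have "sum ?f (insert ?n ` Pow {..<?n})
      = - (\<Sum>A\<in>Pow {..<?n}. if contains_reduced (nths Q A @ [s]) g then (-1) ^ card A else 0)"
    unfolding sum.reindex[OF inj] sum_negf[symmetric]
    by (intro sum.cong) (simp_all add: nths_snoc card)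
  finally show ?thesis by simp
qed

lemma alternating_sum_snoc_ascent:
  assumes "g \<in> carrier G" "s \<in> S" "len g < len (g \<otimes> s)"
  shows "alternating_sum (Q @ [s]) g = 0"
  unfolding alternating_sum_snoc contains_reduced_snoc_ascent[OF assms] by (simp add: alternating_sum_eq_if)

lemma alternating_sum_snoc_descent:
  assumes "g \<in> carrier G" "s \<in> S" "len (g \<otimes> s) < len g"
  shows "alternating_sum (Q @ [s]) g = alternating_sum Q g - alternating_sum Q (g \<otimes> s)"
  unfolding alternating_sum_snoc contains_reduced_snoc_descent[OF assms] by (simp add: alternating_sum_eq_if)

lemma contains_reduced_Nil: "contains_reduced [] g \<longleftrightarrow> g = \<one>"
proof -
  have "contains_reduced [] g \<longleftrightarrow> reduced [] g"
    unfolding contains_reduced_def by (metis list_emb_Nil list_emb_Nil2)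
  then show ?thesis by (auto simp: reduced_expression_def len_one)
qed

text \<open>The case distinction on whether \<open>g s\<close> is longer than \<open>g\<close> matches the recursion of the Demazure
  product: \<open>\<delta>(Q s)\<close> always has \<open>s\<close> as a right descent, so it is different from \<open>g\<close> when \<open>g s\<close> is
  longer; otherwise it is \<open>g\<close> exactly when \<open>\<delta>(Q)\<close> is \<open>g\<close> or \<open>g s\<close>. The two summands of the recursion
  cannot cancel, since \<open>\<delta>(Q)\<close> makes at most one of them non-zero.\<close>

theorem alternating_sum_nonzero_iff:
  assumes "Q \<in> lists S" "g \<in> carrier G"
  shows "alternating_sum Q g \<noteq> 0 \<longleftrightarrow> demazure Q = g"
  using assms
proof (induction Q arbitrary: g rule: rev_induct)
  case Nil
  have "alternating_sum [] g = (if g = \<one> then 1 else 0)" by (simp add: alternating_sum_eq_if contains_reduced_Nil)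
  then show ?case by (auto simp: demazure_Nil)
next
  case (snoc s Q)
  define d where "d = demazure Q"
  have s: "s \<in> S" and Q: "Q \<in> lists S" and g: "g \<in> carrier G" using snoc.prems by auto
  have d: "d \<in> carrier G" using demazure_closed Q by (simp add: d_def)
  have IH: "alternating_sum Q h \<noteq> 0 \<longleftrightarrow> d = h" if "h \<in> carrier G" for h
    using snoc.IH[OF Q that] by (simp add: d_def)
  have dem: "demazure (Q @ [s]) = (if len (d \<otimes> s) > len d then d \<otimes> s else d)"
    by (simp add: demazure_snoc d_def)
  \<comment> \<open>The branch of the recursion in which \<open>s\<close> is appended gives \<open>g\<close> iff \<open>d\<close> is \<open>g s\<close>.\<close>
  have solve: "d = g \<otimes> s \<longleftrightarrow> d \<otimes> s = g" using d g s S_cancel(2) by metis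
  show ?case
  proof (cases "len g < len (g \<otimes> s)")
    case True
    have "demazure (Q @ [s]) \<noteq> g"
      using True d s len_mult_neq[OF d s] by (auto simp: dem)
    then show ?thesis using alternating_sum_snoc_ascent[OF g s True] by simp
  next
    case False
    then have less: "len (g \<otimes> s) < len g" using len_mult_neq[OF g s] by simp
    have gs: "g \<otimes> s \<in> carrier G" using g s by simp
    have "\<not> (d = g \<and> d = g \<otimes> s)" using less by auto
    then have "alternating_sum (Q @ [s]) g \<noteq> 0 \<longleftrightarrow> d = g \<or> d = g \<otimes> s"
      using alternating_sum_snoc_descent[OF g s less] IH[OF g] IH[OF gs] by auto
    also have "\<dots> \<longleftrightarrow> demazure (Q @ [s]) = g"
      unfolding dem using less solve g s by auto
    finally show ?thesis .
  qed
qed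

end

section \<open>Counting monomials by support and degree\<close>

definition mdegree :: "(nat \<Rightarrow>\<^sub>0 nat) \<Rightarrow> nat" where
  "mdegree e = (\<Sum>i\<in>Poly_Mapping.keys e. Poly_Mapping.lookup e i)"

definition monomials_on :: "nat set \<Rightarrow> nat \<Rightarrow> (nat \<Rightarrow>\<^sub>0 nat) set" where
  "monomials_on F k = {e. Poly_Mapping.keys e = F \<and> mdegree e = k}"

lemma keys_add_nat:
  "Poly_Mapping.keys (a + b :: nat \<Rightarrow>\<^sub>0 nat) = Poly_Mapping.keys a \<union> Poly_Mapping.keys b"
  by (auto simp: in_keys_iff lookup_add)

lemma mdegree_superset:
  assumes "finite A" "Poly_Mapping.keys e \<subseteq> A"
  shows "mdegree e = (\<Sum>i\<in>A. Poly_Mapping.lookup e i)"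
  unfolding mdegree_def using assms by (intro sum.mono_neutral_left) (auto simp: in_keys_iff)

lemma mdegree_add: "mdegree (a + b) = mdegree a + mdegree b"
proof -
  let ?A = "Poly_Mapping.keys a \<union> Poly_Mapping.keys b"
  have "mdegree e = (\<Sum>i\<in>?A. Poly_Mapping.lookup e i)" if "Poly_Mapping.keys e \<subseteq> ?A" for e
    using that by (intro mdegree_superset) auto
  then show ?thesis by (simp add: keys_add_nat lookup_add sum.distrib)
qed

lemma mdegree_single [simp]: "mdegree (Poly_Mapping.single i n) = n"
  by (simp add: mdegree_def)

lemma mdegree_zero [simp]: "mdegree 0 = 0"
  by (simp add: mdegree_def)

lemma monomials_on_empty: "monomials_on {} k = (if k = 0 then {0} else {})"
proof -
  have "Poly_Mapping.keys e = {} \<longleftrightarrow> e = 0" for e :: "nat \<Rightarrow>\<^sub>0 nat" by simp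
  then show ?thesis by (auto simp: monomials_on_def)
qed

lemma monomials_on_degree_zero:
  assumes "F \<noteq> {}" shows "monomials_on F 0 = {}"
proof -
  have "mdegree e \<noteq> 0" if "Poly_Mapping.keys e = F" for e
    using that assms by (auto simp: mdegree_def in_keys_iff)
  then show ?thesis by (auto simp: monomials_on_def)
qed

text \<open>Dividing a monomial by one of its variables \<open>x\<^sub>i\<close> lowers the degree by one and either
  removes \<open>i\<close> from the support or leaves the support unchanged.\<close>

lemma monomials_on_insert_Suc:
  assumes "i \<notin> F"
  shows "monomials_on (insert i F) (Suc k) =
    (\<lambda>e. e + Poly_Mapping.single i 1) ` (monomials_on F k \<union> monomials_on (insert i F) k)"
proof (intro equalityI subsetI)
  fix e assume e: "e \<in> monomials_on (insert i F) (Suc k)"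
  then have pos: "Poly_Mapping.lookup e i \<ge> 1"
    by (simp add: monomials_on_def in_keys_iff set_eq_iff) (metis not_less_eq_eq le0 less_one not_less)
  define e' where "e' = e - Poly_Mapping.single i 1"
  have eq: "e = e' + Poly_Mapping.single i 1"
    using pos by (intro poly_mapping_eqI) (auto simp: e'_def lookup_add lookup_minus lookup_single when_def)
  have "mdegree e' = k" using e unfolding monomials_on_def by (subst (asm) eq) (simp add: mdegree_add)
  moreover have "Poly_Mapping.keys e' = F \<or> Poly_Mapping.keys e' = insert i F"
    using e assms unfolding monomials_on_def
    by (subst (asm) eq) (auto simp: keys_add_nat)
  ultimately have "e' \<in> monomials_on F k \<union> monomials_on (insert i F) k"
    by (auto simp: monomials_on_def)
  then show "e \<in> (\<lambda>e. e + Poly_Mapping.single i 1) ` (monomials_on F k \<union> monomials_on (insert i F) k)"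
    using eq by blast
next
  fix e assume "e \<in> (\<lambda>e. e + Poly_Mapping.single i 1) ` (monomials_on F k \<union> monomials_on (insert i F) k)"
  then obtain e' where e': "e = e' + Poly_Mapping.single i 1"
    "Poly_Mapping.keys e' = F \<or> Poly_Mapping.keys e' = insert i F" "mdegree e' = k"
    by (auto simp: monomials_on_def)
  then have "Poly_Mapping.keys e = insert i F" by (auto simp: keys_add_nat)
  moreover have "mdegree e = Suc k" using e' by (simp add: mdegree_add)
  ultimately show "e \<in> monomials_on (insert i F) (Suc k)" by (simp add: monomials_on_def)
qed

text \<open>These are the compositions of \<open>k\<close> into \<open>card F\<close> positive parts; the previous lemma is Pascal's
  rule for their number.\<close>

lemma finite_card_monomials_on:
  assumes "finite F"
  shows "finite (monomials_on F k) \<and> card (monomials_on F k) =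
    (if F = {} then if k = 0 then 1 else 0
     else if k = 0 then 0 else (k - 1) choose (card F - 1))"
  using assms
proof (induction F arbitrary: k)
  case empty
  show ?case by (simp add: monomials_on_empty)
next
  case (insert i F)
  show ?case
  proof (induction k)
    case 0
    show ?case by (simp add: monomials_on_degree_zero)
  next
    case (Suc k)
    have inj: "inj_on (\<lambda>e. e + Poly_Mapping.single i (1::nat)) A" for A
      by (auto simp: inj_on_def)
    have disj: "monomials_on F k \<inter> monomials_on (insert i F) k = {}"
      using insert.hyps by (auto simp: monomials_on_def)
    have "card (monomials_on (insert i F) (Suc k))
        = card (monomials_on F k) + card (monomials_on (insert i F) k)"
      unfolding monomials_on_insert_Suc[OF insert.hyps(2)] card_image[OF inj]
      using insert.IH[of k] Suc disj by (simp add: card_Un_disjoint)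
    also have "\<dots> = k choose card F"
    proof (cases "F = {}")
      case False
      then obtain n where "card F = Suc n" using insert.hyps by (metis card_eq_0_iff not0_implies_Suc)
      then show ?thesis using insert.IH[of k] Suc insert.hyps False by (cases k) auto
    qed (use insert.IH[of k] Suc in \<open>auto split: if_splits\<close>)
    finally show ?case
      unfolding monomials_on_insert_Suc[OF insert.hyps(2), of k]
      using insert.IH[of k] Suc insert.hyps by simp
  qed
qed

text \<open>The polynomial \<open>(x - 1) gchoose (n - 1)\<close>. The value \<open>0\<close> for \<open>n = 0\<close> is the count of
  monomials with empty support in every positive degree.\<close>

definition positive_compositions_poly :: "nat \<Rightarrow> real poly" where
  "positive_compositions_poly n =
     (if n = 0 then 0
      else Polynomial.smult (1 / fact (n - 1)) (\<Prod>j<n - 1. [:- 1 - of_nat j, 1:]))"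

lemma poly_positive_compositions:
  assumes "n > 0"
  shows "poly (positive_compositions_poly n) x = (x - 1) gchoose (n - 1)"
  using assms
  by (simp add: positive_compositions_poly_def gbinomial_prod_rev poly_prod algebra_simps atLeast0LessThan)

text \<open>The correction in degree \<open>0\<close> comes from \<open>(-1) gchoose (n - 1) = (-1)\<^bsup>n - 1\<^esup>\<close>, while no monomial
  of degree \<open>0\<close> has non-empty support; for empty support it is the constant monomial.\<close>

lemma card_monomials_on:
  assumes "finite F"
  shows "real (card (monomials_on F k)) =
    poly (positive_compositions_poly (card F)) (real k) + (if k = 0 then (- 1) ^ card F else 0)"
proof (cases "F = {}")
  case True
  then show ?thesis by (simp add: monomials_on_empty positive_compositions_poly_def)
next
  case False
  then obtain n where n: "card F = Suc n" using assms by (metis card_eq_0_iff not0_implies_Suc)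
  show ?thesis
  proof (cases k)
    case 0
    have "(- 1 :: real) gchoose n = (- 1) ^ n"
      using gbinomial_minus[of "1::real" n] binomial_gbinomial[of n n, where 'a = real] by simp
    then show ?thesis using 0 n False finite_card_monomials_on[OF assms, of 0]
      by (simp add: poly_positive_compositions)
  next
    case (Suc j)
    then show ?thesis using n False finite_card_monomials_on[OF assms, of k]
      by (simp add: poly_positive_compositions binomial_gbinomial)
  qed
qed

lemma poly_eq_of_eventually_eq:
  fixes p q :: "real poly"
  assumes "\<forall>k\<ge>N. poly p (real k) = poly q (real k)"
  shows "p = q"
proof (rule ccontr)
  assume "p \<noteq> q"
  then have "finite {x. poly (p - q) x = 0}" by (intro poly_roots_finite) simp
  moreover have "real ` {N..} \<subseteq> {x. poly (p - q) x = 0}" using assms by auto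
  ultimately have "finite (real ` {N..})" by (rule finite_subset[rotated])
  then show False using infinite_Ici by (auto dest: finite_imageD simp: inj_on_def)
qed

text \<open>The polynomial parts of \<open>card_monomials_on\<close> add up to the Hilbert polynomial, and the corrections
  in degree \<open>0\<close> add up to the alternating sum.\<close>

theorem hilbertian_iff:
  assumes D: "finite D" "\<And>F. F \<in> D \<Longrightarrow> finite F"
    and HF: "\<And>k. hilbert_function m I k = card (\<Union>F\<in>D. monomials_on F k)"
  shows "hilbertian m I \<longleftrightarrow> (\<Sum>F\<in>D. (- 1) ^ card F) = (0::int)"
proof -
  define p where "p = (\<Sum>F\<in>D. positive_compositions_poly (card F))"
  have "card (\<Union>F\<in>D. monomials_on F k) = (\<Sum>F\<in>D. card (monomials_on F k))" for k
    using D finite_card_monomials_on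
    by (intro card_UN_disjoint) (auto simp: monomials_on_def)
  then have hf: "real (hilbert_function m I k) =
      poly p (real k) + (if k = 0 then (\<Sum>F\<in>D. (- 1) ^ card F) else 0)" for k
    using D by (simp add: HF p_def poly_sum card_monomials_on sum.distrib)
  have "hilbert_polynomial m I = p"
    unfolding hilbert_polynomial_def
  proof (rule the_equality)
    show "\<exists>N. \<forall>k\<ge>N. real (hilbert_function m I k) = poly p (real k)"
      by (rule exI[of _ 1]) (simp add: hf)
  next
    fix q assume "\<exists>N. \<forall>k\<ge>N. real (hilbert_function m I k) = poly q (real k)"
    then obtain N where N: "\<And>k. k \<ge> N \<Longrightarrow> real (hilbert_function m I k) = poly q (real k)" by blast
    have "poly q (real k) = poly p (real k)" if "k \<ge> N + 1" for k
      using N[of k] hf[of k] that by simp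
    then have "\<forall>k\<ge>N + 1. poly q (real k) = poly p (real k)" by blast
    then show "q = p" by (rule poly_eq_of_eventually_eq)
  qed
  then have "hilbertian m I \<longleftrightarrow> (\<Sum>F\<in>D. (- 1) ^ card F) = (0::real)"
    by (auto simp: hilbertian_def hf)
  also have "(\<Sum>F\<in>D. (- 1) ^ card F) = (0::real) \<longleftrightarrow> (\<Sum>F\<in>D. (- 1) ^ card F) = (0::int)"
  proof -
    have "(\<Sum>F\<in>D. (- 1) ^ card F) = real_of_int (\<Sum>F\<in>D. (- 1) ^ card F)" by simp
    then show ?thesis by (metis of_int_0_eq_iff)
  qed
  finally show ?thesis .
qed

section \<open>Graded components of quotients of the polynomial ring\<close>

lemma cpoly_ring_simps [simp]:
  "mult (cpoly_ring m) = (*)" "one (cpoly_ring m) = 1"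
  "zero (cpoly_ring m) = 0" "add (cpoly_ring m) = (+)"
  by (simp_all add: cpoly_ring_def)

lemma mem_cpoly_ring:
  "p \<in> carrier (cpoly_ring m) \<longleftrightarrow>
     (\<forall>e\<in>Poly_Mapping.keys p. Poly_Mapping.keys e \<subseteq> {..<m})"
  by (simp add: cpoly_ring_def)

lemma keys_multE:
  assumes "e \<in> Poly_Mapping.keys (p * q :: cpoly)"
  obtains a b where "a \<in> Poly_Mapping.keys p" "b \<in> Poly_Mapping.keys q" "e = a + b"
  using assms keys_mult[of p q] by blast

lemma keys_diff: "Poly_Mapping.keys (p - q :: cpoly) \<subseteq> Poly_Mapping.keys p \<union> Poly_Mapping.keys q"
  by (auto simp: in_keys_iff lookup_minus)

lemma cpoly_carrier_closed [simp]:
  assumes "p \<in> carrier (cpoly_ring m)" "q \<in> carrier (cpoly_ring m)"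
  shows "p + q \<in> carrier (cpoly_ring m)" "p - q \<in> carrier (cpoly_ring m)"
    "p * q \<in> carrier (cpoly_ring m)" "- p \<in> carrier (cpoly_ring m)"
proof -
  show "p * q \<in> carrier (cpoly_ring m)"
    using assms unfolding mem_cpoly_ring by (auto elim!: keys_multE simp: keys_add_nat subset_iff)
qed (use assms keys_add[of p q] keys_diff[of p q] in \<open>auto simp: mem_cpoly_ring in_keys_iff\<close>)

lemma cpoly_zero_one_const [simp]:
  "0 \<in> carrier (cpoly_ring m)" "1 \<in> carrier (cpoly_ring m)"
  "cpoly_const c \<in> carrier (cpoly_ring m)"
  by (auto simp: mem_cpoly_ring cpoly_const_def)

lemma cring_cpoly_ring: "cring (cpoly_ring m)"
proof (rule cringI)
  show "abelian_group (cpoly_ring m)"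
  proof (rule abelian_groupI)
    fix p assume "p \<in> carrier (cpoly_ring m)"
    then show "\<exists>q\<in>carrier (cpoly_ring m). q \<oplus>\<^bsub>cpoly_ring m\<^esub> p = \<zero>\<^bsub>cpoly_ring m\<^esub>"
      by (intro bexI[of _ "- p"]) auto
  qed (auto simp: algebra_simps)
  show "comm_monoid (cpoly_ring m)"
    by (rule comm_monoidI) (auto simp: algebra_simps)
qed (auto simp: algebra_simps)

lemma cpoly_a_minus:
  assumes "p \<in> carrier (cpoly_ring m)" "q \<in> carrier (cpoly_ring m)"
  shows "p \<ominus>\<^bsub>cpoly_ring m\<^esub> q = p - q"
proof -
  interpret cring "cpoly_ring m" by (rule cring_cpoly_ring)
  have "\<ominus>\<^bsub>cpoly_ring m\<^esub> q = - q" using assms by (intro minus_equality) auto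
  then show ?thesis by (simp add: a_minus_def)
qed

lemma mem_homogeneous_part:
  "p \<in> homogeneous_part m k \<longleftrightarrow> p \<in> carrier (cpoly_ring m) \<and>
     (\<forall>e\<in>Poly_Mapping.keys p. mdegree e = k)"
  by (simp add: homogeneous_part_def mdegree_def)

lemma homogeneous_part_closed:
  shows "p \<in> homogeneous_part m k \<Longrightarrow> q \<in> homogeneous_part m k \<Longrightarrow> p + q \<in> homogeneous_part m k"
    and "p \<in> homogeneous_part m k \<Longrightarrow> - p \<in> homogeneous_part m k"
    and "p \<in> homogeneous_part m k \<Longrightarrow> cpoly_const c * p \<in> homogeneous_part m k"
proof -
  show "cpoly_const c * p \<in> homogeneous_part m k" if "p \<in> homogeneous_part m k"
    using that
    by (auto simp: mem_homogeneous_part cpoly_const_def[of c] split: if_splits elim!: keys_multE)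
      (auto simp: mem_homogeneous_part simp flip: cpoly_const_def)
qed (use keys_add[of p q] in \<open>auto simp: mem_homogeneous_part in_keys_iff\<close>)

lemma homogeneous_part_zero: "0 \<in> homogeneous_part m k"
  by (simp add: mem_homogeneous_part)

text \<open>Elements of a graded component are cosets of homogeneous polynomials. The next lemmas translate
  its operations into polynomial arithmetic on representatives.\<close>

locale cpoly_ideal =
  fixes m :: nat and I :: "cpoly set"
  assumes ideal: "ideal I (cpoly_ring m)"
begin

abbreviation "cls p \<equiv> I +>\<^bsub>cpoly_ring m\<^esub> p"

lemma cls_eq_iff:
  assumes "p \<in> carrier (cpoly_ring m)" "q \<in> carrier (cpoly_ring m)"
  shows "cls p = cls q \<longleftrightarrow> p - q \<in> I"
  using ring.quotient_eq_iff_same_a_r_cos[OF cring.axioms(1)[OF cring_cpoly_ring] ideal assms]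
    cpoly_a_minus[OF assms] by simp

lemma cls_zero: "cls 0 = I"
proof -
  interpret ideal I "cpoly_ring m" by (rule ideal)
  have "0 \<in> I"
    using additive_subgroup.zero_closed[OF ideal.axioms(1)[OF ideal]] by simp
  then show ?thesis by (rule a_rcos_zero[OF ideal])
qed

lemma component_simps:
  "carrier (graded_component m I k) = cls ` homogeneous_part m k"
  "zero (graded_component m I k) = cls 0"
  by (simp_all add: graded_component_def quotient_algebra_def FactRing_def Let_def cls_zero)

lemma component_add:
  assumes "p \<in> carrier (cpoly_ring m)" "q \<in> carrier (cpoly_ring m)"
  shows "cls p \<oplus>\<^bsub>graded_component m I k\<^esub> cls q = cls (p + q)"
proof -
  interpret ideal I "cpoly_ring m" by (rule ideal)
  show ?thesis using a_rcos_sum[OF assms]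
    by (simp add: graded_component_def quotient_algebra_def FactRing_def Let_def)
qed

lemma component_smult:
  assumes "p \<in> carrier (cpoly_ring m)"
  shows "c \<odot>\<^bsub>graded_component m I k\<^esub> cls p = cls (cpoly_const c * p)"
proof -
  interpret ideal I "cpoly_ring m" by (rule ideal)
  show ?thesis using rcoset_mult_add[of "cpoly_const c" p] assms
    by (simp add: graded_component_def quotient_algebra_def FactRing_def Let_def)
qed

lemma homogeneous_carrier: "p \<in> homogeneous_part m k \<Longrightarrow> p \<in> carrier (cpoly_ring m)"
  by (simp add: mem_homogeneous_part)

lemmas component_rules = component_simps component_add component_smult homogeneous_carrier
  homogeneous_part_closed homogeneous_part_zero

lemma cpoly_const_simps:
  "cpoly_const (a + b) = cpoly_const a + cpoly_const b"
  "cpoly_const (a * b) = cpoly_const a * cpoly_const b"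
  "cpoly_const 1 = 1"
  by (simp_all add: cpoly_const_def single_add mult_single)

lemma vectorspace_component: "vectorspace class_ring (graded_component m I k)"
proof (intro vectorspace.intro Module.module.intro)
  let ?V = "graded_component m I k"
  show "abelian_group ?V"
  proof (rule abelian_groupI)
    fix x assume "x \<in> carrier ?V"
    then obtain p where p: "p \<in> homogeneous_part m k" "x = cls p" by (auto simp: component_rules)
    moreover have "p \<in> carrier (cpoly_ring m)" using p(1) by (rule homogeneous_carrier)
    ultimately show "\<exists>y\<in>carrier ?V. y \<oplus>\<^bsub>?V\<^esub> x = \<zero>\<^bsub>?V\<^esub>"
      by (intro bexI[of _ "cls (- p)"])
        (simp_all add: component_simps component_add homogeneous_part_closed)
  qed (auto simp: component_rules algebra_simps)
  show "module_axioms class_ring ?V"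
    by (rule module_axioms.intro) (auto simp: component_rules cpoly_const_simps distrib_left distrib_right mult.assoc)
  show "cring (class_ring :: complex ring)" by (rule class_cring.cring_axioms)
  show "field (class_ring :: complex ring)" by (rule class_field)
qed

text \<open>The linear combinations of the classes of distinct monomials are the classes of the polynomials with the
  same coefficients. Injectivity on \<open>E\<close> is needed because the coefficient function \<open>a\<close> is indexed by classes.\<close>

lemma component_finsum:
  assumes "finite E" "inj_on (\<lambda>e. cls (Poly_Mapping.single e 1)) E"
    and "\<And>e. e \<in> E \<Longrightarrow> Poly_Mapping.keys e \<subseteq> {..<m} \<and> mdegree e = k"
  shows "finsum (graded_component m I k) (\<lambda>v. a v \<odot>\<^bsub>graded_component m I k\<^esub> v)
            ((\<lambda>e. cls (Poly_Mapping.single e 1)) ` E)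
       = cls (\<Sum>e\<in>E. Poly_Mapping.single e (a (cls (Poly_Mapping.single e 1))))"
    (is "finsum ?V ?f (?b ` E) = _")
proof -
  interpret vectorspace class_ring ?V by (rule vectorspace_component)
  have hom: "Poly_Mapping.single e c \<in> homogeneous_part m k" if "e \<in> E" for e c
    using assms(3)[OF that] by (auto simp: mem_homogeneous_part mem_cpoly_ring)
  have f: "?f (?b e) = cls (Poly_Mapping.single e (a (?b e)))" if "e \<in> E" for e
    using homogeneous_carrier[OF hom[OF that]]
    by (simp add: component_smult cpoly_const_def mult_single)
  have in_carrier: "cls (Poly_Mapping.single e c) \<in> carrier ?V" if "e \<in> E" for e c
    using hom[OF that] by (simp add: component_simps)
  have "finsum ?V ?f (?b ` E) = finsum ?V (\<lambda>e. ?f (?b e)) E"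
    using assms(2) by (intro finsum_reindex) (auto simp: f in_carrier)
  also have "\<dots> = finsum ?V (\<lambda>e. cls (Poly_Mapping.single e (a (?b e)))) E"
    by (intro finsum_cong') (auto simp: f in_carrier)
  also have "\<dots> = cls (\<Sum>e\<in>E. Poly_Mapping.single e (a (?b e)))"
  proof -
    have sum_hom: "(\<Sum>e\<in>A. Poly_Mapping.single e (c e)) \<in> homogeneous_part m k" if "A \<subseteq> E" for A c
      using that by (induction A rule: infinite_finite_induct)
        (simp_all add: homogeneous_part_closed(1) hom homogeneous_part_zero)
    have "finsum ?V (\<lambda>e. cls (Poly_Mapping.single e (c e))) A = cls (\<Sum>e\<in>A. Poly_Mapping.single e (c e))"
      if "finite A" "A \<subseteq> E" for A c
      using that
    proof (induction A)
      case empty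
      show ?case by (simp add: component_simps)
    next
      case (insert e A)
      then have "finsum ?V (\<lambda>e. cls (Poly_Mapping.single e (c e))) (insert e A)
          = cls (Poly_Mapping.single e (c e)) \<oplus>\<^bsub>?V\<^esub> cls (\<Sum>e\<in>A. Poly_Mapping.single e (c e))"
        by (subst finsum_insert) (auto intro!: in_carrier)
      also have "\<dots> = cls (Poly_Mapping.single e (c e) + (\<Sum>e\<in>A. Poly_Mapping.single e (c e)))"
        using insert.prems by (intro component_add homogeneous_carrier[OF sum_hom] homogeneous_carrier[OF hom]) auto
      finally show ?case using insert.hyps by simp
    qed
    from this[OF assms(1) order_refl] show ?thesis .
  qed
  finally show ?thesis .
qed

end

definition nonface_polys :: "nat \<Rightarrow> nat set set \<Rightarrow> cpoly set" where
  "nonface_polys m D =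
     {p \<in> carrier (cpoly_ring m). \<forall>e\<in>Poly_Mapping.keys p. Poly_Mapping.keys e \<notin> D}"

text \<open>Multiplying monomials unites their supports, and a set containing a non-face is a non-face.\<close>

lemma nonface_polys_ideal:
  assumes down: "\<And>A B. A \<subseteq> B \<Longrightarrow> B \<in> D \<Longrightarrow> A \<in> D"
  shows "ideal (nonface_polys m D) (cpoly_ring m)"
proof (rule idealI)
  interpret cring "cpoly_ring m" by (rule cring_cpoly_ring)
  show "ring (cpoly_ring m)" by (rule ring_axioms)
  show "subgroup (nonface_polys m D) (add_monoid (cpoly_ring m))"
  proof (rule add.subgroupI)
    show "nonface_polys m D \<subseteq> carrier (cpoly_ring m)" by (auto simp: nonface_polys_def)
    have "0 \<in> nonface_polys m D" by (simp add: nonface_polys_def)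
    then show "nonface_polys m D \<noteq> {}" by blast
  next
    fix p assume p: "p \<in> nonface_polys m D"
    then have "\<ominus>\<^bsub>cpoly_ring m\<^esub> p = - p"
      by (intro minus_equality) (auto simp: nonface_polys_def)
    with p show "\<ominus>\<^bsub>cpoly_ring m\<^esub> p \<in> nonface_polys m D"
      by (auto simp: nonface_polys_def in_keys_iff)
  next
    fix p q assume "p \<in> nonface_polys m D" "q \<in> nonface_polys m D"
    then show "p \<oplus>\<^bsub>cpoly_ring m\<^esub> q \<in> nonface_polys m D"
      using keys_add[of p q] by (auto simp: nonface_polys_def)
  qed
  fix p q assume pq: "p \<in> nonface_polys m D" "q \<in> carrier (cpoly_ring m)"
  show "q \<otimes>\<^bsub>cpoly_ring m\<^esub> p \<in> nonface_polys m D"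
    using pq by (auto simp: nonface_polys_def keys_add_nat elim!: keys_multE dest: down[rotated])
  then show "p \<otimes>\<^bsub>cpoly_ring m\<^esub> q \<in> nonface_polys m D"
    by (simp add: mult.commute)
qed

lemma prod_cpoly_var:
  "finite A \<Longrightarrow> (\<Prod>i\<in>A. cpoly_var i) = Poly_Mapping.single (\<Sum>i\<in>A. Poly_Mapping.single i 1) 1"
  by (induction A rule: finite_induct) (simp_all add: cpoly_var_def mult_single)

lemma keys_sum_single_one:
  fixes A :: "nat set"
  shows "finite A \<Longrightarrow> Poly_Mapping.keys (\<Sum>i\<in>A. Poly_Mapping.single i (1::nat)) = A"
  by (induction A rule: finite_induct) (simp_all add: keys_add_nat)

lemma cpoly_sum_monomials:
  "(p :: cpoly) = (\<Sum>e\<in>Poly_Mapping.keys p. Poly_Mapping.single e (Poly_Mapping.lookup p e))"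
proof (rule poly_mapping_eqI)
  fix e
  show "Poly_Mapping.lookup p e =
    Poly_Mapping.lookup (\<Sum>e\<in>Poly_Mapping.keys p. Poly_Mapping.single e (Poly_Mapping.lookup p e)) e"
    by (simp add: lookup_sum lookup_single when_def in_keys_iff)
qed

text \<open>A monomial whose support \<open>\<tau>\<close> is a non-face is a multiple of the generator belonging to \<open>\<tau>\<close>.
  Conversely the generators are monomials of this kind.\<close>

lemma stanley_reisner_ideal_eq:
  assumes down: "\<And>A B. A \<subseteq> B \<Longrightarrow> B \<in> D \<Longrightarrow> A \<in> D"
  shows "stanley_reisner_ideal m D = nonface_polys m D"
proof -
  interpret cring "cpoly_ring m" by (rule cring_cpoly_ring)
  define gens :: "cpoly set" where "gens = {\<Prod>i\<in>\<tau>. cpoly_var i | \<tau>. \<tau> \<subseteq> {..<m} \<and> \<tau> \<notin> D}"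
  have gens: "gens \<subseteq> nonface_polys m D"
  proof
    fix p assume "p \<in> gens"
    then obtain \<tau> where \<tau>: "\<tau> \<subseteq> {..<m}" "\<tau> \<notin> D" "p = (\<Prod>i\<in>\<tau>. cpoly_var i)"
      by (auto simp: gens_def)
    moreover have "finite \<tau>" using \<tau>(1) finite_subset by blast
    ultimately show "p \<in> nonface_polys m D"
      by (simp add: prod_cpoly_var nonface_polys_def mem_cpoly_ring keys_sum_single_one del: One_nat_def)
  qed
  interpret I: ideal "Idl\<^bsub>cpoly_ring m\<^esub> gens" "cpoly_ring m"
    using gens by (intro genideal_ideal) (auto simp: nonface_polys_def)
  have monomial: "Poly_Mapping.single e c \<in> Idl\<^bsub>cpoly_ring m\<^esub> gens"
    if e: "Poly_Mapping.keys e \<subseteq> {..<m}" "Poly_Mapping.keys e \<notin> D" for e c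
  proof -
    define u where "u = (\<Sum>i\<in>Poly_Mapping.keys e. Poly_Mapping.single i (1::nat))"
    have u: "Poly_Mapping.lookup u i = (if i \<in> Poly_Mapping.keys e then 1 else 0)" for i
      by (simp add: u_def lookup_sum lookup_single when_def)
    \<comment> \<open>\<open>u\<close> is the exponent vector of the generator; the truncated subtraction is exact.\<close>
    have eq: "e = (e - u) + u"
      by (rule poly_mapping_eqI) (auto simp: lookup_add lookup_minus u in_keys_iff)
    have "Poly_Mapping.single u 1 \<in> gens"
      using e prod_cpoly_var[OF finite_keys, of e] unfolding gens_def u_def
      by (intro CollectI exI[of _ "Poly_Mapping.keys e"]) simp
    then have "Poly_Mapping.single u 1 \<in> Idl\<^bsub>cpoly_ring m\<^esub> gens"
      using genideal_self[of gens] gens by (auto simp: nonface_polys_def)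
    moreover have "Poly_Mapping.single (e - u) c \<in> carrier (cpoly_ring m)"
    proof -
      have "Poly_Mapping.keys (e - u) \<subseteq> Poly_Mapping.keys e" by (auto simp: in_keys_iff lookup_minus)
      then show ?thesis using e by (auto simp: mem_cpoly_ring)
    qed
    ultimately have "Poly_Mapping.single (e - u) c * Poly_Mapping.single u 1 \<in> Idl\<^bsub>cpoly_ring m\<^esub> gens"
      using I.I_l_closed by simp
    then show ?thesis using eq by (simp add: mult_single)
  qed
  have "nonface_polys m D \<subseteq> Idl\<^bsub>cpoly_ring m\<^esub> gens"
  proof
    fix p assume p: "p \<in> nonface_polys m D"
    have "(\<Sum>e\<in>A. Poly_Mapping.single e (Poly_Mapping.lookup p e)) \<in> Idl\<^bsub>cpoly_ring m\<^esub> gens"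
      if "finite A" "A \<subseteq> Poly_Mapping.keys p" for A
      using that
    proof (induction A)
      case empty
      show ?case using I.zero_closed by simp
    next
      case (insert e A)
      then have "Poly_Mapping.single e (Poly_Mapping.lookup p e) \<in> Idl\<^bsub>cpoly_ring m\<^esub> gens"
        using p by (intro monomial) (auto simp: nonface_polys_def mem_cpoly_ring)
      with insert show ?case using I.a_closed by fastforce
    qed
    then show "p \<in> Idl\<^bsub>cpoly_ring m\<^esub> gens"
      using cpoly_sum_monomials[of p] by (metis finite_keys order_refl)
  qed
  moreover have "Idl\<^bsub>cpoly_ring m\<^esub> gens \<subseteq> nonface_polys m D"
    using genideal_minimal[OF nonface_polys_ideal[OF down] gens] .
  ultimately show ?thesis unfolding stanley_reisner_ideal_def gens_def by blast
qed

text \<open>The classes of the monomials with support a face form a basis: modulo the ideal a polynomial is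
  equal to the part of it supported on faces, and no non-zero combination of such monomials lies in the ideal.\<close>

theorem hilbert_function_nonface_polys:
  assumes down: "\<And>A B. A \<subseteq> B \<Longrightarrow> B \<in> D \<Longrightarrow> A \<in> D" and D: "D \<subseteq> Pow {..<m}"
  shows "hilbert_function m (nonface_polys m D) k = card (\<Union>F\<in>D. monomials_on F k)"
proof -
  let ?I = "nonface_polys m D"
  interpret cpoly_ideal m ?I
    by (rule cpoly_ideal.intro, rule nonface_polys_ideal, rule down)
  define V where "V = graded_component m ?I k"
  interpret V: vectorspace class_ring V unfolding V_def by (rule vectorspace_component)
  define E where "E = (\<Union>F\<in>D. monomials_on F k)"
  define b where "b e = cls (Poly_Mapping.single e 1)" for e
  have finE: "finite E"
    unfolding E_def using D finite_card_monomials_on finite_subset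
    by (intro finite_UN_I) (auto dest: finite_subset)
  have E: "Poly_Mapping.keys e \<subseteq> {..<m} \<and> mdegree e = k" "Poly_Mapping.keys e \<in> D" if "e \<in> E" for e
    using that D by (auto simp: E_def monomials_on_def)
  have single: "Poly_Mapping.single e c \<in> carrier (cpoly_ring m)" if "e \<in> E" for e c
    using E[OF that] by (auto simp: mem_cpoly_ring)
  have inj: "inj_on b E"
  proof (rule inj_onI, rule ccontr)
    fix e e' assume ee: "e \<in> E" "e' \<in> E" "b e = b e'" "e \<noteq> e'"
    then have "Poly_Mapping.single e 1 - Poly_Mapping.single e' 1 \<in> ?I"
      using cls_eq_iff single by (simp add: b_def)
    moreover have "e \<in> Poly_Mapping.keys (Poly_Mapping.single e (1::complex) - Poly_Mapping.single e' 1)"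
      using ee by (simp add: in_keys_iff lookup_minus lookup_single)
    ultimately show False using E[OF ee(1)] by (auto simp: nonface_polys_def)
  qed
  have lincomb: "V.lincomb a (b ` E) = cls (\<Sum>e\<in>E. Poly_Mapping.single e (a (b e)))" for a
    unfolding V.lincomb_def unfolding V_def b_def
    using component_finsum[OF finE _ E(1)] inj by (simp add: b_def[abs_def])
  have lookup: "Poly_Mapping.lookup (\<Sum>e\<in>E. Poly_Mapping.single e (c e)) e = (if e \<in> E then c e else 0)"
    for c :: "_ \<Rightarrow> complex" and e
    using finE by (simp add: lookup_sum lookup_single when_def)
  have sum_carrier: "(\<Sum>e\<in>E. Poly_Mapping.single e (c e)) \<in> carrier (cpoly_ring m)"
    for c :: "_ \<Rightarrow> complex"
    unfolding mem_cpoly_ring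
  proof
    fix e assume "e \<in> Poly_Mapping.keys (\<Sum>e\<in>E. Poly_Mapping.single e (c e))"
    then have "e \<in> E" by (auto simp: in_keys_iff lookup split: if_splits)
    then show "Poly_Mapping.keys e \<subseteq> {..<m}" using E by blast
  qed
  have sub: "b ` E \<subseteq> carrier V"
    using E single by (auto simp: V_def component_simps b_def mem_homogeneous_part)
  have "V.lin_indpt (b ` E)"
  proof (rule V.finite_lin_indpt2)
    fix a assume "V.lincomb a (b ` E) = \<zero>\<^bsub>V\<^esub>"
    then have "cls (\<Sum>e\<in>E. Poly_Mapping.single e (a (b e))) = cls 0"
      using lincomb by (simp add: V_def component_simps)
    then have in_I: "(\<Sum>e\<in>E. Poly_Mapping.single e (a (b e))) \<in> ?I"
      using cls_eq_iff sum_carrier by simp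
    have "a (b e) = 0" if "e \<in> E" for e
    proof (rule ccontr)
      assume "a (b e) \<noteq> 0"
      then have "e \<in> Poly_Mapping.keys (\<Sum>e\<in>E. Poly_Mapping.single e (a (b e)))"
        using that by (simp add: in_keys_iff lookup)
      then show False using in_I E(2)[OF that] by (auto simp: nonface_polys_def)
    qed
    then show "\<forall>v\<in>b ` E. a v = \<zero>\<^bsub>class_ring\<^esub>" by simp
  qed (use finE sub in auto)
  moreover have "V.gen_set (b ` E)"
  proof -
    have "x \<in> V.span (b ` E)" if x: "x \<in> carrier V" for x
    proof -
      obtain p where p: "p \<in> homogeneous_part m k" "x = cls p"
        using x by (auto simp: V_def component_simps)
      \<comment> \<open>The coefficients of \<open>p\<close>, transported from exponent vectors to classes.\<close>
      define a where "a v = Poly_Mapping.lookup p (the_inv_into E b v)" for v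
      have a: "a (b e) = Poly_Mapping.lookup p e" if "e \<in> E" for e
        using that inj by (simp add: a_def the_inv_into_f_f)
      have "p - (\<Sum>e\<in>E. Poly_Mapping.single e (a (b e))) \<in> ?I"
      proof -
        have "Poly_Mapping.keys e \<notin> D"
          if "e \<in> Poly_Mapping.keys (p - (\<Sum>e\<in>E. Poly_Mapping.single e (a (b e))))" for e
        proof
          assume face: "Poly_Mapping.keys e \<in> D"
          have ne: "Poly_Mapping.lookup p e \<noteq> (if e \<in> E then a (b e) else 0)"
            using that by (simp add: in_keys_iff lookup lookup_minus)
          have "e \<notin> E" using ne a[of e] by auto
          then have "e \<in> Poly_Mapping.keys p" using ne by (simp add: in_keys_iff)
          then have "mdegree e = k" using p(1) by (simp add: mem_homogeneous_part)
          then show False using face \<open>e \<notin> E\<close> by (simp add: E_def monomials_on_def)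
        qed
        then show ?thesis using homogeneous_carrier[OF p(1)] sum_carrier
          by (simp add: nonface_polys_def)
      qed
      then have "x = V.lincomb a (b ` E)"
        using cls_eq_iff homogeneous_carrier[OF p(1)] sum_carrier lincomb p(2) by simp
      then show ?thesis using finE V.finite_span[OF _ sub] by auto
    qed
    moreover have "V.span (b ` E) \<subseteq> carrier V" by (rule V.span_is_subset2[OF sub])
    ultimately show ?thesis by blast
  qed
  ultimately have "V.basis (b ` E)" using sub by (simp add: V.basis_def)
  then have "V.dim = card (b ` E)" using finE by (intro V.dim_basis) auto
  then show ?thesis
    using card_image[OF inj] by (simp add: hilbert_function_def V_def E_def)
qed

section \<open>Subword complexes and the Hilbertian property\<close>

lemma subseq_nths_mono: "A \<subseteq> B \<Longrightarrow> subseq (nths w A) (nths w B)"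
proof (induction w arbitrary: A B)
  case (Cons s w)
  have "subseq (nths w {j. Suc j \<in> A}) (nths w {j. Suc j \<in> B})"
    using Cons.prems by (intro Cons.IH) auto
  then show ?case using Cons.prems by (auto simp: nths_Cons)
qed simp

context coxeter_group
begin

text \<open>A reduced expression inside the word left after deleting \<open>F\<close> is obtained by deleting a larger set,
  which is a facet containing \<open>F\<close>.\<close>

lemma mem_subword_complex_iff:
  "F \<in> subword_complex G S Q g \<longleftrightarrow>
     F \<subseteq> {..<length Q} \<and> contains_reduced (nths Q ({..<length Q} - F)) g"
proof
  assume "F \<in> subword_complex G S Q g"
  then obtain F' where F': "F \<subseteq> F'" "F' \<subseteq> {..<length Q}" "reduced (nths Q ({..<length Q} - F')) g"
    by (auto simp: subword_complex_def subword_facets_def)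
  moreover have "subseq (nths Q ({..<length Q} - F')) (nths Q ({..<length Q} - F))"
    using F'(1) by (intro subseq_nths_mono) auto
  ultimately show "F \<subseteq> {..<length Q} \<and> contains_reduced (nths Q ({..<length Q} - F)) g"
    unfolding contains_reduced_def by blast
next
  assume F: "F \<subseteq> {..<length Q} \<and> contains_reduced (nths Q ({..<length Q} - F)) g"
  then obtain v where v: "subseq v (nths Q ({..<length Q} - F))" "reduced v g"
    by (auto simp: contains_reduced_def)
  then obtain B where "v = nths (nths Q ({..<length Q} - F)) B" by (auto simp: subseq_conv_nths)
  then obtain A where A: "v = nths Q A" "A \<subseteq> {..<length Q} - F"
    unfolding nths_nths by blast
  have "{..<length Q} - ({..<length Q} - A) = A" using A(2) by auto
  then have "{..<length Q} - A \<in> subword_facets G S Q g"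
    using v(2) A(1) by (simp add: subword_facets_def)
  moreover have "F \<subseteq> {..<length Q} - A" using F A(2) by auto
  ultimately show "F \<in> subword_complex G S Q g" by (auto simp: subword_complex_def)
qed

text \<open>Complementation of position sets turns the sum over faces into the sum over kept positions.\<close>

lemma sum_subword_complex:
  "(\<Sum>F\<in>subword_complex G S Q g. (- 1) ^ card F) = (- 1) ^ length Q * alternating_sum Q g"
proof -
  let ?U = "{..<length Q}"
  let ?A = "{A. A \<subseteq> ?U \<and> contains_reduced (nths Q A) g}"
  have "bij_betw (\<lambda>A. ?U - A) ?A (subword_complex G S Q g)"
    by (rule bij_betwI[where g = "\<lambda>F. ?U - F"])
      (auto simp: mem_subword_complex_iff double_diff)
  then have "(\<Sum>F\<in>subword_complex G S Q g. (- 1) ^ card F) = (\<Sum>A\<in>?A. (- 1 :: int) ^ card (?U - A))"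
    by (rule sum.reindex_bij_betw[symmetric])
  also have "\<dots> = (\<Sum>A\<in>?A. (- 1) ^ length Q * (- 1) ^ card A)"
  proof (rule sum.cong)
    fix A assume "A \<in> ?A"
    then have A: "A \<subseteq> ?U" "finite A" using finite_subset by auto
    have "card A \<le> length Q" using card_mono[OF _ A(1)] by simp
    then have "length Q + card A = card (?U - A) + 2 * card A"
      using A by (simp add: card_Diff_subset)
    then show "(- 1 :: int) ^ card (?U - A) = (- 1) ^ length Q * (- 1) ^ card A"
      by (metis power_add power_even_eq mult_1_right power_minus1_even)
  qed simp
  finally show ?thesis by (simp add: alternating_sum_def sum_distrib_left)
qed

end

theorem theorem5p2:
  fixes G :: "('a, 'b) monoid_scheme" and S :: "'a set" and Q :: "'a list" and \<pi> :: 'a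
  assumes "coxeter_system G S"
    and "set Q \<subseteq> S"
    and "\<pi> \<in> carrier G"
  shows "hilbertian (length Q) (stanley_reisner_ideal (length Q) (subword_complex G S Q \<pi>))
           \<longleftrightarrow> demazure_product G S Q \<noteq> \<pi>"
proof -
  interpret group G using assms(1) by (simp add: coxeter_system_def)
  interpret coxeter_group G S by unfold_locales (rule assms(1))
  let ?D = "subword_complex G S Q \<pi>"
  have down: "A \<in> ?D" if "A \<subseteq> B" "B \<in> ?D" for A B
    using that by (auto simp: subword_complex_def)
  have D: "?D \<subseteq> Pow {..<length Q}" by (auto simp: mem_subword_complex_iff)
  have "hilbertian (length Q) (stanley_reisner_ideal (length Q) ?D) \<longleftrightarrow>
      (\<Sum>F\<in>?D. (- 1) ^ card F) = (0::int)"
  proof (rule hilbertian_iff)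
    show "finite ?D" using D by (rule finite_subset) simp
    show "finite F" if "F \<in> ?D" for F using D that finite_subset by blast
    show "hilbert_function (length Q) (stanley_reisner_ideal (length Q) ?D) k =
        card (\<Union>F\<in>?D. monomials_on F k)" for k
    proof -
      have "stanley_reisner_ideal (length Q) ?D = nonface_polys (length Q) ?D"
        using down by (rule stanley_reisner_ideal_eq)
      moreover have "hilbert_function (length Q) (nonface_polys (length Q) ?D) k =
          card (\<Union>F\<in>?D. monomials_on F k)"
        using down D by (rule hilbert_function_nonface_polys)
      ultimately show ?thesis by simp
    qed
  qed
  also have "\<dots> \<longleftrightarrow> alternating_sum Q \<pi> = 0" by (simp add: sum_subword_complex)
  also have "\<dots> \<longleftrightarrow> demazure_product G S Q \<noteq> \<pi>"
    using alternating_sum_nonzero_iff[of Q \<pi>] assms(2,3) by (auto simp: in_lists_conv_set)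
  finally show ?thesis .
qed

end
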